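(* There exist two increasing functions $f,g\in C(\mathbb{R},\mathbb{R})$ having the following properties (a)--(c): (a) for any $\lambda>0$ there exists a unique solution $(u_\lambda,v_\lambda)\in\mathbb{R}^2$ to the system of algebraic equations $$\lambda u+f(u-v)=0,\qquad \lambda v+g(v-u)=0;$$ (b) the family of the solutions $(u_\lambda,v_\lambda)$, $\lambda>0$, is bounded in $\mathbb{R}^2$; (c) the family $\{(u_\lambda,v_\lambda)\}_{\lambda>0}$ does not converge as $\lambda\to 0+$.
   Context: $C(\mathbb{R},\mathbb{R})$ is the set of continuous functions from $\mathbb{R}$ to $\mathbb{R}$. "Increasing" means strictly increasing (the weak notion is called "nondecreasing"). The unknowns of the system are the two real numbers $u,v$, and $\lambda>0$ is a parameter. *)

theory Defs
  imports "HOL-Analysis.Analysis"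
begin

definition solves_system ::
    "(real \<Rightarrow> real) \<Rightarrow> (real \<Rightarrow> real) \<Rightarrow> real \<Rightarrow> real \<times> real \<Rightarrow> bool" where
  "solves_system f g lam p \<longleftrightarrow>
     (case p of (u, v) \<Rightarrow> lam * u + f (u - v) = 0 \<and> lam * v + g (v - u) = 0)"

end

theory Submission
  imports Defs "HOL-Real_Asymp.Real_Asymp"
begin

text \<open>
  Subtracting the two equations gives the scalar equation
  \<open>\<lambda> z + f z - g (- z) = 0\<close> for \<open>z = u - v\<close>. If \<open>f z\<close> and \<open>- g (- z)\<close> vanish at a common
  point \<open>z\<^sub>0 \<noteq> 0\<close>, then \<open>z\<close> tends to \<open>z\<^sub>0\<close> as \<open>\<lambda> \<rightarrow> 0\<close>, but how \<open>z\<close> splits into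
  \<open>u\<close> and \<open>- v\<close> is governed by the ratio of the two vanishing quantities, and this ratio is free
  to oscillate.

  Here \<open>z\<^sub>0 = 1\<close>, and in terms of \<open>t = z - 1\<close> the two quantities are \<open>2 t \<plusminus> t sin (ln \<bar>t\<bar>)\<close>.
  Their sum is \<open>4 t\<close>, so the scalar equation is linear and the system can be solved
  in closed form: \<open>t = - \<lambda> / (4 + \<lambda>)\<close>, and \<open>u\<close>, \<open>v\<close> are \<open>(S \<plusminus> 2) / (4 + \<lambda>)\<close> with
  \<open>S = sin (ln (\<lambda> / (4 + \<lambda>)))\<close>. This is bounded and oscillates as \<open>\<lambda> \<rightarrow> 0\<close>.
  Monotonicity and continuity of \<open>f\<close> and \<open>g\<close> both come from the fact that the slopes of chords
  of \<open>t sin (ln \<bar>t\<bar>)\<close> are smaller than \<open>2\<close> in absolute value (\<open>log_wave_chord\<close>).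
\<close>

lemma abs_diff_sin_le: "\<bar>sin x - sin y\<bar> \<le> \<bar>x - y\<bar>" for x y :: real
proof -
  have "\<bar>sin x - sin y\<bar> = 2 * (\<bar>sin ((x - y) / 2)\<bar> * \<bar>cos ((x + y) / 2)\<bar>)"
    by (simp add: sin_diff_sin abs_mult)
  also have "\<dots> \<le> 2 * (\<bar>(x - y) / 2\<bar> * 1)"
    by (intro mult_left_mono mult_mono abs_sin_x_le_abs_x) auto
  finally show ?thesis
    by simp
qed

definition log_wave :: "real \<Rightarrow> real" where
  "log_wave t = t * sin (ln \<bar>t\<bar>)"

lemma log_wave_minus: "log_wave (- t) = - log_wave t"
  by (simp add: log_wave_def)

lemma abs_log_wave_le: "\<bar>log_wave t\<bar> \<le> \<bar>t\<bar>"
  by (simp add: log_wave_def abs_mult mult_left_le)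

text \<open>
  The change is split into one from the factor \<open>t\<close>, of size at most \<open>t - s\<close>, and one from the
  phase \<open>ln t\<close>, of size at most \<open>s ln (t / s) < s (t / s - 1) = t - s\<close>.
\<close>

lemma log_wave_chord_pos:
  assumes "0 < s" "s < t"
  shows "\<bar>log_wave t - log_wave s\<bar> < 2 * (t - s)"
proof -
  have "log_wave t - log_wave s = (t - s) * sin (ln t) + s * (sin (ln t) - sin (ln s))"
    using assms by (simp add: log_wave_def algebra_simps)
  moreover have "\<bar>(t - s) * sin (ln t)\<bar> \<le> t - s"
    using assms by (simp add: abs_mult mult_left_le)
  moreover have "\<bar>s * (sin (ln t) - sin (ln s))\<bar> < t - s"
  proof -
    have "\<bar>sin (ln t) - sin (ln s)\<bar> \<le> \<bar>ln t - ln s\<bar>"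
      by (rule abs_diff_sin_le)
    also have "\<dots> = ln (t / s)"
      using assms by (simp add: ln_div)
    also have "\<dots> < t / s - 1"
      using assms ln_le_minus_one[of "t / s"] ln_eq_minus_one[of "t / s"] by fastforce
    finally have "s * \<bar>sin (ln t) - sin (ln s)\<bar> < s * (t / s - 1)"
      using assms by simp
    then show ?thesis
      unfolding abs_mult using assms by (simp add: right_diff_distrib)
  qed
  ultimately show ?thesis
    using abs_triangle_ineq[of "(t - s) * sin (ln t)" "s * (sin (ln t) - sin (ln s))"] by simp
qed

lemma log_wave_chord:
  assumes "s < t"
  shows "\<bar>log_wave t - log_wave s\<bar> < 2 * (t - s)"
proof -
  consider "0 < s" | "t < 0" | "s \<le> 0" "0 \<le> t"
    by linarith
  then show ?thesis
  proof cases
    case 1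
    then show ?thesis
      using assms by (rule log_wave_chord_pos)
  next
    case 2
    then show ?thesis
      using log_wave_chord_pos[of "- t" "- s"] assms by (simp add: log_wave_minus)
  next
    case 3
    then show ?thesis
      using abs_log_wave_le[of s] abs_log_wave_le[of t] assms
      by (auto simp: abs_le_iff abs_less_iff)
  qed
qed

lemma continuous_on_log_wave [continuous_intros]:
  assumes "continuous_on A h"
  shows "continuous_on A (\<lambda>x. log_wave (h x))"
proof -
  have "dist (log_wave x) (log_wave y) \<le> 2 * dist x y" for x y
    using log_wave_chord[of x y] log_wave_chord[of y x]
    by (cases x y rule: linorder_cases) (auto simp: dist_real_def)
  then have "2-lipschitz_on UNIV log_wave"
    by (auto intro: lipschitz_onI)
  then have "continuous_on UNIV log_wave"
    by (rule lipschitz_on_continuous_on)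
  then show ?thesis
    using assms by (rule continuous_on_compose2) simp
qed

definition osc_f :: "real \<Rightarrow> real" where
  "osc_f x = 2 * (x - 1) + log_wave (x - 1)"

text \<open>
  The shift and the sign are such that \<open>osc_f z = 2 t + log_wave t\<close> and
  \<open>- osc_g (- z) = 2 t - log_wave t\<close> for \<open>t = z - 1\<close>.
\<close>

definition osc_g :: "real \<Rightarrow> real" where
  "osc_g y = 2 * (y + 1) - log_wave (y + 1)"

lemma continuous_osc: "continuous_on UNIV osc_f" "continuous_on UNIV osc_g"
  unfolding osc_f_def osc_g_def by (intro continuous_intros)+

lemma strict_mono_osc_f: "strict_mono osc_f"
proof (rule strict_monoI)
  fix x y :: real
  assume "x < y"
  then show "osc_f x < osc_f y"
    using log_wave_chord[of "x - 1" "y - 1"] by (simp add: osc_f_def)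
qed

lemma strict_mono_osc_g: "strict_mono osc_g"
proof (rule strict_monoI)
  fix x y :: real
  assume "x < y"
  then show "osc_g x < osc_g y"
    using log_wave_chord[of "x + 1" "y + 1"] by (simp add: osc_g_def)
qed

definition osc_sol :: "real \<Rightarrow> real \<times> real" where
  "osc_sol lam = (let S = sin (ln (lam / (4 + lam))) in ((S + 2) / (4 + lam), (S - 2) / (4 + lam)))"

text \<open>
  The wave terms enter both equations with the same sign, so they cancel in the difference, which
  determines \<open>t = u - v - 1\<close>; each equation then gives its own unknown.
\<close>

lemma solves_system_osc_iff:
  assumes "lam > 0"
  shows "solves_system osc_f osc_g lam p \<longleftrightarrow> p = osc_sol lam"
proof -
  obtain u v where p: "p = (u, v)"
    by (cases p)
  define t where "t = - (lam / (4 + lam))"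
  define S where "S = sin (ln (lam / (4 + lam)))"
  have g: "osc_g (v - u) = - 2 * (u - v - 1) + log_wave (u - v - 1)"
    using log_wave_minus[of "u - v - 1"] by (simp add: osc_g_def algebra_simps)
  have wave: "log_wave t = t * S"
    using assms by (simp add: log_wave_def t_def S_def)
  have t: "(4 + lam) * t = - lam"
    using assms by (simp add: t_def)
  have sol: "p = osc_sol lam \<longleftrightarrow> (4 + lam) * u = S + 2 \<and> (4 + lam) * v = S - 2"
    using assms by (auto simp: p osc_sol_def S_def Let_def field_simps)
  have "solves_system osc_f osc_g lam p \<longleftrightarrow>
      lam * u + 2 * (u - v - 1) + log_wave (u - v - 1) = 0 \<and>
      lam * v - 2 * (u - v - 1) + log_wave (u - v - 1) = 0"
    by (simp add: solves_system_def p g osc_f_def algebra_simps)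
  also have "\<dots> \<longleftrightarrow> u - v - 1 = t \<and> lam * u + 2 * t + t * S = 0 \<and> lam * v - 2 * t + t * S = 0"
    (is "?A \<longleftrightarrow> ?B")
  proof
    assume A: ?A
    then have "(4 + lam) * (u - v - 1) = (4 + lam) * t"
      unfolding t by (simp add: algebra_simps)
    then have "u - v - 1 = t"
      using assms by simp
    with A show ?B
      by (simp add: wave)
  next
    assume ?B
    then show ?A
      by (simp add: wave)
  qed
  also have "\<dots> \<longleftrightarrow> (4 + lam) * u = S + 2 \<and> (4 + lam) * v = S - 2"
    (is "_ \<longleftrightarrow> ?C")
  proof
    assume B: ?B
    have "lam * ((4 + lam) * u) = (4 + lam) * (lam * u + 2 * t + t * S) - ((4 + lam) * t) * (S + 2)"
      by (simp add: algebra_simps)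
    then have u: "lam * ((4 + lam) * u) = lam * (S + 2)"
      using B t by simp
    have "lam * ((4 + lam) * v) = (4 + lam) * (lam * v - 2 * t + t * S) - ((4 + lam) * t) * (S - 2)"
      by (simp add: algebra_simps)
    then have v: "lam * ((4 + lam) * v) = lam * (S - 2)"
      using B t by simp
    show ?C
      using u v assms by simp
  next
    assume ?C
    then have uv: "u = (S + 2) / (4 + lam)" "v = (S - 2) / (4 + lam)"
      using assms by (simp_all add: field_simps)
    show ?B
      unfolding uv t_def using assms by (simp add: divide_simps) (simp add: algebra_simps)
  qed
  finally show ?thesis
    by (simp add: sol)
qed

lemma bounded_osc_sol: "bounded (osc_sol ` {0<..})"
proof (rule boundedI)
  fix p
  assume "p \<in> osc_sol ` {0<..}"
  then obtain lam where lam: "lam > 0" "p = osc_sol lam"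
    by auto
  define S where "S = sin (ln (lam / (4 + lam)))"
  have S: "\<bar>S\<bar> \<le> 1"
    by (simp add: S_def)
  have p: "p = ((S + 2) / (4 + lam), (S - 2) / (4 + lam))"
    by (simp add: lam osc_sol_def S_def Let_def)
  have "\<bar>(S + 2) / (4 + lam)\<bar> \<le> 1" "\<bar>(S - 2) / (4 + lam)\<bar> \<le> 1"
    using lam(1) S by (auto simp: abs_le_iff divide_simps)
  then show "norm p \<le> 2"
    unfolding p using norm_Pair_le[of "(S + 2) / (4 + lam)" "(S - 2) / (4 + lam)"] by simp
qed

text \<open>
  The parameters \<open>lam\<close> chosen here are those with \<open>ln (lam / (4 + lam)) = - (a + 2 \<pi> n)\<close>; they
  tend to \<open>0\<close> and keep the sine constant, so each phase \<open>a\<close> contributes its own limit point.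
\<close>

lemma osc_sol_limit_imp:
  assumes lim: "(osc_sol \<longlongrightarrow> L) (at_right 0)" and a: "a > 0"
  shows "fst L = (2 - sin a) / 4"
proof -
  define l where "l n = 4 / (exp (a + 2 * pi * real n) - 1)" for n :: nat
  have exp_gt: "exp (a + 2 * pi * real n) > 1" for n
    using a by (simp add: add_pos_nonneg)
  have l_pos: "l n > 0" for n
    using exp_gt[of n] by (simp add: l_def)
  have l_ratio: "l n / (4 + l n) = exp (- (a + 2 * pi * real n))" for n
  proof -
    have "E > 1 \<Longrightarrow> 4 / (E - 1) / (4 + 4 / (E - 1)) = inverse E" for E :: real
      by (simp add: field_simps)
    then show ?thesis
      unfolding l_def exp_minus using exp_gt by blast
  qed
  have fst_sol: "fst (osc_sol (l n)) = (2 - sin a) / (4 + l n)" for n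
  proof -
    have "sin (a + 2 * pi * real n) = sin a"
      using sin_2npi[of n] cos_2npi[of n] by (simp add: sin_add mult_ac)
    then show ?thesis
      unfolding osc_sol_def l_ratio Let_def ln_exp sin_minus by simp
  qed
  have l_lim: "l \<longlonglongrightarrow> 0"
    unfolding l_def using pi_gt_zero by real_asymp
  then have "filterlim l (at_right 0) sequentially"
    using l_pos by (intro tendsto_imp_filterlim_at_right) simp_all
  with lim have "(\<lambda>n. osc_sol (l n)) \<longlonglongrightarrow> L"
    by (rule filterlim_compose)
  then have "(\<lambda>n. fst (osc_sol (l n))) \<longlonglongrightarrow> fst L"
    by (rule tendsto_fst)
  moreover have "(\<lambda>n. fst (osc_sol (l n))) \<longlonglongrightarrow> (2 - sin a) / (4 + 0)"
    unfolding fst_sol by (intro tendsto_intros l_lim) simp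
  ultimately show ?thesis
    using LIMSEQ_unique by fastforce
qed

theorem theorem1:
  shows "\<exists>f g :: real \<Rightarrow> real.
           continuous_on UNIV f \<and> strict_mono f \<and>
           continuous_on UNIV g \<and> strict_mono g \<and>
           (\<forall>lam>0. \<exists>!p. solves_system f g lam p) \<and>
           (\<exists>w :: real \<Rightarrow> real \<times> real.
              (\<forall>lam>0. solves_system f g lam (w lam)) \<and>
              bounded (w ` {0<..}) \<and>
              \<not> (\<exists>L. (w \<longlongrightarrow> L) (at_right 0)))"
proof (rule exI[of _ osc_f], rule exI[of _ osc_g], intro conjI exI[of _ osc_sol])
  show "\<forall>lam>0. \<exists>!p. solves_system osc_f osc_g lam p"
    by (simp add: solves_system_osc_iff)
  show "\<forall>lam>0. solves_system osc_f osc_g lam (osc_sol lam)"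
    by (simp add: solves_system_osc_iff)
  show "\<not> (\<exists>L. (osc_sol \<longlongrightarrow> L) (at_right 0))"
  proof
    assume "\<exists>L. (osc_sol \<longlongrightarrow> L) (at_right 0)"
    then obtain L where L: "(osc_sol \<longlongrightarrow> L) (at_right 0)" ..
    have "fst L = (2 - sin (pi / 2)) / 4" "fst L = (2 - sin pi) / 4"
      using osc_sol_limit_imp[OF L] pi_gt_zero pi_half_gt_zero by blast+
    then show False
      by simp
  qed
qed (fact continuous_osc strict_mono_osc_f strict_mono_osc_g bounded_osc_sol)+

end
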